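(* There are constants $c>0$ and $\delta_0>0$ such that the following holds. Let $\tilde u\in\mathcal{H}^3_0[a,b]$ and let $\{\psi_m\}\subset\mathcal{L}^2[a,b]$ be a sequence such that $G_{\tilde u}(\psi_m)\to0$ as $m\to\infty$. Then for every $\delta$ with $0<\delta\le\delta_0$ and every $u\in\mathcal{H}^3_0[a,b]$ with $\|u-\tilde u\|_{\mathcal{H}^1}\le\delta$, there exists $M(\delta)\in\mathbb{N}$ such that for all $m\ge M(\delta)$, $$G_u(\psi_m)\le c\,\delta^2 .$$
   Context: All functions are real-valued on a bounded closed interval $[a,b]\subset\mathbb{R}$, $a<b$. $\mathcal{H}^q[a,b]$ is the usual Sobolev space of functions $f$ with $f,f',\dots,f^{(q)}\in\mathcal{L}^2[a,b]$, with $\|f\|_{\mathcal{H}^1}^2=\|f\|_{\mathcal{L}^2}^2+\|f'\|_{\mathcal{L}^2}^2$. $\mathcal{H}^q_0[a,b]$ denotes the set of $f\in\mathcal{H}^q[a,b]$ with $f(a)=f(b)=0$ (only the function values vanish, not the derivatives). The operator $T_D:\mathcal{L}^2[a,b]\to\mathcal{L}^2[a,b]$ is $(T_D\psi)(x)=\int_a^x\psi(\xi)\,d\xi$. For $\psi\in\mathcal{L}^2[a,b]$, $u_\psi$ is the unique solution of $-u_\psi''=T_D\psi$ with $u_\psi(a)=u_\psi(b)=0$. For $v\in\mathcal{H}^3_0[a,b]$, the functional based on $v$ is $G_v(\psi)=\|v'-u_\psi'\|_{\mathcal{L}^2}^2$, $\psi\in\mathcal{L}^2[a,b]$. *)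

theory Defs
  imports "HOL-Analysis.Analysis"
begin

text \<open>
  Elements of \<open>L\<^sup>2[a,b]\<close> and of the Sobolev spaces are represented by functions on the reals,
  of which only the values on \<open>[a,b]\<close> matter, up to equality almost everywhere.
\<close>

definition l2_space :: "real \<Rightarrow> real \<Rightarrow> (real \<Rightarrow> real) set" where
  "l2_space a b = {f. f \<in> borel_measurable (lebesgue_on {a..b}) \<and>
                      integrable (lebesgue_on {a..b}) (\<lambda>x. (f x)\<^sup>2)}"

definition l2_norm :: "real \<Rightarrow> real \<Rightarrow> (real \<Rightarrow> real) \<Rightarrow> real" where
  "l2_norm a b f = sqrt (LINT x|lebesgue_on {a..b}. (f x)\<^sup>2)"

text \<open>
  The test functions \<open>C\<^sub>c\<^sup>\<infinity>(a,b)\<close>, extended by zero to the whole line; the support is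
  automatically compact, being a closed subset of a bounded set.
\<close>

definition test_functions :: "real \<Rightarrow> real \<Rightarrow> (real \<Rightarrow> real) set" where
  "test_functions a b = {\<phi>. (\<forall>k x. (deriv ^^ k) \<phi> field_differentiable at x) \<and>
                            closure {x. \<phi> x \<noteq> 0} \<subseteq> {a<..<b}}"

definition locally_integrable :: "real \<Rightarrow> real \<Rightarrow> (real \<Rightarrow> real) \<Rightarrow> bool" where
  "locally_integrable a b f \<longleftrightarrow>
     (\<forall>c d. a < c \<and> d < b \<longrightarrow> f absolutely_integrable_on {c..d})"

text \<open>\<open>g\<close> is the weak derivative of order \<open>k\<close> of \<open>f\<close> on \<open>(a,b)\<close>.\<close>

definition has_weak_deriv ::
    "nat \<Rightarrow> real \<Rightarrow> real \<Rightarrow> (real \<Rightarrow> real) \<Rightarrow> (real \<Rightarrow> real) \<Rightarrow> bool" where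
  "has_weak_deriv k a b f g \<longleftrightarrow>
     locally_integrable a b f \<and> locally_integrable a b g \<and>
     (\<forall>\<phi>\<in>test_functions a b.
        (LINT x|lebesgue_on {a..b}. f x * (deriv ^^ k) \<phi> x) =
        (- 1) ^ k * (LINT x|lebesgue_on {a..b}. g x * \<phi> x))"

text \<open>Weak derivatives are unique almost everywhere; an arbitrary representative is chosen.\<close>

definition weak_deriv :: "nat \<Rightarrow> real \<Rightarrow> real \<Rightarrow> (real \<Rightarrow> real) \<Rightarrow> real \<Rightarrow> real" where
  "weak_deriv k a b f = (SOME g. has_weak_deriv k a b f g)"

definition sobolev :: "nat \<Rightarrow> real \<Rightarrow> real \<Rightarrow> (real \<Rightarrow> real) set" where
  "sobolev q a b = {f \<in> l2_space a b. \<forall>k\<le>q. \<exists>g\<in>l2_space a b. has_weak_deriv k a b f g}"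

definition h1_norm :: "real \<Rightarrow> real \<Rightarrow> (real \<Rightarrow> real) \<Rightarrow> real" where
  "h1_norm a b f = sqrt ((l2_norm a b f)\<^sup>2 + (l2_norm a b (weak_deriv 1 a b f))\<^sup>2)"

text \<open>
  The boundary values of a Sobolev function (\<open>q \<ge> 1\<close>) are those of its continuous
  representative. Only the function itself vanishes at \<open>a\<close> and \<open>b\<close>, not its derivatives, so
  this is not the closure of the test functions.
\<close>

definition sobolev0 :: "nat \<Rightarrow> real \<Rightarrow> real \<Rightarrow> (real \<Rightarrow> real) set" where
  "sobolev0 q a b = {f \<in> sobolev q a b.
     \<exists>g. continuous_on {a..b} g \<and> (AE x in lebesgue_on {a..b}. f x = g x) \<and> g a = 0 \<and> g b = 0}"

definition T_D :: "real \<Rightarrow> (real \<Rightarrow> real) \<Rightarrow> real \<Rightarrow> real" where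
  "T_D a \<psi> x = (LINT \<xi>|lebesgue_on {a..x}. \<psi> \<xi>)"

text \<open>
  As \<open>T_D a \<psi>\<close> is continuous on \<open>[a,b]\<close>, the boundary value problem is understood
  classically, with one-sided derivatives at the endpoints.
\<close>

definition solves_bvp :: "real \<Rightarrow> real \<Rightarrow> (real \<Rightarrow> real) \<Rightarrow> (real \<Rightarrow> real) \<Rightarrow> bool" where
  "solves_bvp a b \<psi> u \<longleftrightarrow>
     (\<exists>u'. \<forall>x\<in>{a..b}. (u has_real_derivative u' x) (at x within {a..b}) \<and>
                      (u' has_real_derivative - T_D a \<psi> x) (at x within {a..b})) \<and>
     u a = 0 \<and> u b = 0"

text \<open>The solution is unique on \<open>[a,b]\<close>; it is extended by zero to make it a unique function.\<close>

definition bvp_solution :: "real \<Rightarrow> real \<Rightarrow> (real \<Rightarrow> real) \<Rightarrow> real \<Rightarrow> real" where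
  "bvp_solution a b \<psi> = (THE u. solves_bvp a b \<psi> u \<and> (\<forall>x. x \<notin> {a..b} \<longrightarrow> u x = 0))"

definition G_functional :: "real \<Rightarrow> real \<Rightarrow> (real \<Rightarrow> real) \<Rightarrow> (real \<Rightarrow> real) \<Rightarrow> real" where
  "G_functional a b v \<psi> =
     (l2_norm a b (\<lambda>x. weak_deriv 1 a b v x - weak_deriv 1 a b (bvp_solution a b \<psi>) x))\<^sup>2"

end

theory Submission imports Defs begin

text \<open>
  Splitting \<open>u' - u\<^sub>\<psi>' = (u' - u\<^sub>t') + (u\<^sub>t' - u\<^sub>\<psi>')\<close> gives
  \<open>G\<^sub>u(\<psi>\<^sub>m) \<le> 2 \<delta>\<^sup>2 + 2 G\<^sub>u\<^sub>t(\<psi>\<^sub>m)\<close>, so \<open>c = 4\<close> works once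
  \<open>G\<^sub>u\<^sub>t(\<psi>\<^sub>m) < \<delta>\<^sup>2\<close>, and \<open>M\<close> does not depend on \<open>u\<close>. Since weak derivatives are
  arbitrarily chosen representatives, this needs their almost everywhere uniqueness, i.e. the
  fundamental lemma of the calculus of variations: the test functions
  \<open>exp (- 1 / (n (x - p))) exp (- 1 / (n (q - x)))\<close> increase to the indicator of \<open>(p, q)\<close>, so a
  function orthogonal to all test functions has vanishing integral over every interval and
  vanishes almost everywhere by Lebesgue differentiation.
\<close>

section \<open>Smooth functions: affine substitution and products\<close>

definition smooth :: "(real \<Rightarrow> real) \<Rightarrow> bool" where
  "smooth f \<longleftrightarrow> (\<forall>k x. (deriv ^^ k) f field_differentiable at x)"

text \<open>A coinduction principle: instead of a formula for the k-th derivative, it suffices to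
  exhibit a class of differentiable functions that is invariant under \<open>deriv\<close>.\<close>

lemma smooth_coinduct:
  assumes "f \<in> S"
    and diff: "\<And>f x. f \<in> S \<Longrightarrow> f field_differentiable at x"
    and closed: "\<And>f. f \<in> S \<Longrightarrow> deriv f \<in> S"
  shows "smooth f"
proof -
  have "(deriv ^^ k) f \<in> S" for k
    by (induction k) (use assms(1) closed in auto)
  then show ?thesis
    using diff by (simp add: smooth_def)
qed

lemma smooth_imp_field_differentiable:
  assumes "smooth f" shows "f field_differentiable at x"
  using assms unfolding smooth_def by (metis funpow_0)

lemma smooth_deriv:
  assumes "smooth f" shows "smooth (deriv f)"
  using assms unfolding smooth_def by (metis funpow_Suc_right o_apply)

lemma smooth_has_real_derivative:
  "smooth f \<Longrightarrow> (f has_real_derivative deriv f x) (at x)"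
  using smooth_imp_field_differentiable field_differentiable_derivI by blast

lemma smooth_continuous_on:
  assumes "smooth f" shows "continuous_on A f"
  by (meson assms continuous_at_imp_continuous_on field_differentiable_imp_continuous_at
      smooth_imp_field_differentiable)

lemma smooth_affine:
  assumes "smooth f" shows "smooth (\<lambda>x. f (c * x + d))"
proof (rule smooth_coinduct)
  \<comment> \<open>The scalar \<open>e\<close> absorbs the factor \<open>c\<close> that the chain
    rule produces at each differentiation.\<close>
  let ?S = "{\<lambda>x. e * g (c * x + d) | e g. smooth g}"
  show "(\<lambda>x. f (c * x + d)) \<in> ?S"
    using assms by (force intro!: exI[of _ 1])
  have D: "((\<lambda>x. e * g (c * x + d)) has_real_derivative (e * c) * deriv g (c * x + d)) (at x)"
    if "smooth g" for e g x
    by (rule derivative_eq_intros DERIV_chain2[OF smooth_has_real_derivative[OF that]] refl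
        | simp)+
  show "h field_differentiable at x" if "h \<in> ?S" for h x
    using that D field_differentiable_def by blast
  show "deriv h \<in> ?S" if h: "h \<in> ?S" for h
  proof -
    from h obtain e g where g: "smooth g" "h = (\<lambda>x. e * g (c * x + d))" by blast
    then have "deriv h = (\<lambda>x. (e * c) * deriv g (c * x + d))"
      using D DERIV_imp_deriv by blast
    then show ?thesis using smooth_deriv[OF g(1)] by blast
  qed
qed

text \<open>By the product rule the derivative of a product is a sum of two products, so single
  products do not form an invariant class. Closing them under addition does.\<close>

inductive_set sums_of_products :: "(real \<Rightarrow> real) set" where
  prod: "smooth f \<Longrightarrow> smooth g \<Longrightarrow> (\<lambda>x. f x * g x) \<in> sums_of_products"
| add: "f \<in> sums_of_products \<Longrightarrow> g \<in> sums_of_products \<Longrightarrow> (\<lambda>x. f x + g x) \<in> sums_of_products"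

lemma smooth_mult:
  assumes "smooth f" "smooth g" shows "smooth (\<lambda>x. f x * g x)"
proof (rule smooth_coinduct)
  show "(\<lambda>x. f x * g x) \<in> sums_of_products"
    by (intro prod assms)
  have *: "\<exists>h'\<in>sums_of_products. \<forall>x. (h has_real_derivative h' x) (at x)"
    if "h \<in> sums_of_products" for h
    using that
  proof induction
    case (prod f g)
    then have "(\<lambda>x. f x * deriv g x + deriv f x * g x) \<in> sums_of_products"
      by (intro sums_of_products.intros smooth_deriv)
    moreover have "((\<lambda>x. f x * g x) has_real_derivative f x * deriv g x + deriv f x * g x) (at x)" for x
      by (rule DERIV_mult' prod smooth_has_real_derivative)+
    ultimately show ?case by (intro bexI[where x="\<lambda>x. f x * deriv g x + deriv f x * g x"]) auto
  next
    case (add f g)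
    then obtain f' g' where "f' \<in> sums_of_products" "\<forall>x. (f has_real_derivative f' x) (at x)"
      "g' \<in> sums_of_products" "\<forall>x. (g has_real_derivative g' x) (at x)" by blast
    then show ?case
      by (intro bexI[where x="\<lambda>x. f' x + g' x"]) (auto intro: DERIV_add sums_of_products.add)
  qed
  show "h field_differentiable at x" if "h \<in> sums_of_products" for h x
    using * that field_differentiable_def by blast
  show "deriv h \<in> sums_of_products" if h: "h \<in> sums_of_products" for h
  proof -
    obtain h' where h': "h' \<in> sums_of_products" "\<forall>x. (h has_real_derivative h' x) (at x)"
      using *[OF h] by blast
    then have "deriv h = h'" using DERIV_imp_deriv by blast
    with h' show ?thesis by simp
  qed
qed

section \<open>Bump functions built from exp (- 1 / x)\<close>

definition flat_exp :: "real poly \<Rightarrow> real \<Rightarrow> real" where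
  "flat_exp P x = (if x > 0 then poly P (1 / x) * exp (- (1 / x)) else 0)"

lemma poly_exp_tendsto_0: "((\<lambda>x::real. poly P x * exp (- x)) \<longlongrightarrow> 0) at_top"
proof -
  have "((\<lambda>x. \<Sum>i\<le>degree P. coeff P i * (x ^ i / exp x)) \<longlongrightarrow> 0) at_top"
    by (intro tendsto_null_sum tendsto_mult_right_zero tendsto_power_div_exp_0)
  then show ?thesis
    by (simp add: poly_altdef exp_minus divide_inverse sum_distrib_right mult.assoc)
qed

text \<open>For h > 0 the difference quotient at 0 is t P(t) exp(-t) with t = 1/h, which tends to 0
  as t grows; \<open>pCons 0 P\<close> is the polynomial t P(t). For h < 0 the quotient is
  0.\<close>

lemma flat_exp_deriv_0: "(flat_exp P has_real_derivative 0) (at 0)"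
proof -
  have "((\<lambda>h. flat_exp P h / h) \<longlongrightarrow> 0) (at 0)"
  proof (rule filterlim_split_at_real)
    have "\<forall>\<^sub>F h in at_left 0. flat_exp P h / h = 0"
      by (simp add: eventually_at_filter flat_exp_def)
    then show "((\<lambda>h. flat_exp P h / h) \<longlongrightarrow> 0) (at_left 0)"
      by (rule tendsto_eventually)
    have "((\<lambda>h. poly (pCons 0 P) (inverse h) * exp (- inverse h)) \<longlongrightarrow> 0) (at_right 0)"
      by (rule filterlim_compose[OF poly_exp_tendsto_0 filterlim_inverse_at_top_right])
    moreover have "\<forall>\<^sub>F h in at_right 0.
      poly (pCons 0 P) (inverse h) * exp (- inverse h) = flat_exp P h / h"
      by (simp add: eventually_at_filter flat_exp_def field_simps)
    ultimately show "((\<lambda>h. flat_exp P h / h) \<longlongrightarrow> 0) (at_right 0)"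
      by (rule Lim_transform_eventually)
  qed
  then show ?thesis
    by (simp add: DERIV_def flat_exp_def[of P 0])
qed

text \<open>With t = 1/x, the chain rule turns P(t) exp(-t) into t^2 (P(t) - P'(t)) exp(-t). The
  polynomial factor is carried along so that the family \<open>flat_exp\<close> is closed under
  differentiation, which gives smoothness by coinduction.\<close>

lemma flat_exp_has_derivative:
  "(flat_exp P has_real_derivative flat_exp (monom 1 2 * (P - pderiv P)) x) (at x)"
proof (cases x "0::real" rule: linorder_cases)
  case less
  have "((\<lambda>x. 0) has_real_derivative flat_exp (monom 1 2 * (P - pderiv P)) x) (at x)"
    using less by (simp add: flat_exp_def)
  then show ?thesis
    by (rule has_field_derivative_transform_within_open[where S="{..<0}"])
       (use less in \<open>auto simp: flat_exp_def\<close>)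
next
  case equal
  then show ?thesis
    using flat_exp_deriv_0 by (simp add: flat_exp_def)
next
  case greater
  have "((\<lambda>x. poly P (1 / x) * exp (- (1 / x))) has_real_derivative
      flat_exp (monom 1 2 * (P - pderiv P)) x) (at x)"
    using greater
    by (auto intro!: derivative_eq_intros DERIV_chain2[OF poly_DERIV]
        simp: flat_exp_def poly_monom field_simps power2_eq_square)
  then show ?thesis
    by (rule has_field_derivative_transform_within_open[where S="{0<..}"])
       (use greater in \<open>auto simp: flat_exp_def\<close>)
qed

lemma smooth_flat_exp: "smooth (flat_exp P)"
proof (rule smooth_coinduct[of _ "range flat_exp"])
  show "deriv f \<in> range flat_exp" if f: "f \<in> range flat_exp" for f
  proof -
    obtain P where "f = flat_exp P" using f by blast
    then have "deriv f = flat_exp (monom 1 2 * (P - pderiv P))"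
      using flat_exp_has_derivative DERIV_imp_deriv by blast
    then show ?thesis by blast
  qed
  show "f field_differentiable at x" if "f \<in> range flat_exp" for f x
    using that flat_exp_has_derivative unfolding field_differentiable_def by blast
qed simp

text \<open>The two factors switch the function off to the left of p and to the right of q. The
  growing scale \<open>Suc n\<close> pushes each factor towards 1 at points where its argument is
  positive.\<close>

definition bump :: "real \<Rightarrow> real \<Rightarrow> nat \<Rightarrow> real \<Rightarrow> real" where
  "bump p q n x = flat_exp 1 (real (Suc n) * (x - p)) * flat_exp 1 (real (Suc n) * (q - x))"

lemma smooth_bump: "smooth (bump p q n)"
proof -
  have "smooth (\<lambda>x. flat_exp 1 (real (Suc n) * x + - (real (Suc n) * p))
      * flat_exp 1 (- real (Suc n) * x + real (Suc n) * q))"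
    by (intro smooth_mult smooth_affine smooth_flat_exp)
  then show ?thesis
    by (simp add: bump_def[abs_def] algebra_simps)
qed

lemma flat_exp_1_bounds: "0 \<le> flat_exp 1 x" "flat_exp 1 x \<le> 1"
  by (auto simp: flat_exp_def)

lemma bump_bounds: "0 \<le> bump p q n x" "bump p q n x \<le> 1"
  unfolding bump_def by (simp_all add: flat_exp_1_bounds mult_le_one)

lemma bump_eq_0: "x \<notin> {p<..<q} \<Longrightarrow> bump p q n x = 0"
  by (auto simp: bump_def flat_exp_def zero_less_mult_iff)

lemma flat_exp_tendsto_1:
  assumes "x > 0" shows "(\<lambda>n. flat_exp 1 (real (Suc n) * x)) \<longlonglongrightarrow> 1"
proof -
  have "(\<lambda>n. exp (- (inverse (real (Suc n)) * (1 / x)))) \<longlonglongrightarrow> exp (- (0 * (1 / x)))"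
    by (intro tendsto_intros LIMSEQ_inverse_real_of_nat)
  moreover have "flat_exp 1 (real (Suc n) * x) = exp (- (inverse (real (Suc n)) * (1 / x)))" for n
    using assms by (simp add: flat_exp_def divide_simps mult.commute)
  ultimately show ?thesis by (simp only:) simp
qed

lemma bump_tendsto_indicator: "(\<lambda>n. bump p q n x) \<longlonglongrightarrow> indicator {p<..<q} x"
proof (cases "x \<in> {p<..<q}")
  case True
  then have "(\<lambda>n. bump p q n x) \<longlonglongrightarrow> 1 * 1"
    unfolding bump_def by (intro tendsto_mult flat_exp_tendsto_1) auto
  with True show ?thesis by simp
qed (simp add: bump_eq_0)

lemma bump_test_function:
  assumes "a < p" "q < b" shows "bump p q n \<in> test_functions a b"
proof -
  have "closure {x. bump p q n x \<noteq> 0} \<subseteq> {p..q}"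
  proof (rule closure_minimal)
    show "{x. bump p q n x \<noteq> 0} \<subseteq> {p..q}"
    proof
      fix x assume "x \<in> {x. bump p q n x \<noteq> 0}"
      then have "x \<in> {p<..<q}" using bump_eq_0 by blast
      then show "x \<in> {p..q}" by simp
    qed
  qed simp
  then show ?thesis
    using assms smooth_bump[of p q n] by (fastforce simp: test_functions_def smooth_def)
qed

section \<open>Test functions and integration against them\<close>

lemma test_function_smooth: "\<phi> \<in> test_functions a b \<Longrightarrow> smooth \<phi>"
  by (auto simp: test_functions_def smooth_def)

text \<open>Off its closed support a test function vanishes on a whole neighbourhood, so its
  derivative vanishes there too and differentiation does not enlarge the support.\<close>

lemma test_function_deriv:
  assumes "\<phi> \<in> test_functions a b" shows "deriv \<phi> \<in> test_functions a b"
proof -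
  have "deriv \<phi> x = 0" if "x \<notin> closure {x. \<phi> x \<noteq> 0}" for x
  proof -
    have "((\<lambda>x. 0) has_real_derivative 0) (at x)" by simp
    then have "(\<phi> has_real_derivative 0) (at x)"
      by (rule has_field_derivative_transform_within_open[where S="- closure {x. \<phi> x \<noteq> 0}"])
        (use that closure_subset[of "{x. \<phi> x \<noteq> 0}"] in auto)
    then show ?thesis by (rule DERIV_imp_deriv)
  qed
  then have "{x. deriv \<phi> x \<noteq> 0} \<subseteq> closure {x. \<phi> x \<noteq> 0}" by blast
  then have "closure {x. deriv \<phi> x \<noteq> 0} \<subseteq> closure {x. \<phi> x \<noteq> 0}"
    by (rule closure_minimal) simp
  with assms smooth_deriv[OF test_function_smooth[OF assms]] show ?thesis
    unfolding test_functions_def smooth_def by blast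
qed

text \<open>The support is compact, so its minimum and maximum lie in it and hence strictly between
  a and b.\<close>

lemma test_function_support:
  assumes "\<phi> \<in> test_functions a b"
  obtains c d where "a < c" "d < b" "\<And>x. x \<notin> {c..d} \<Longrightarrow> \<phi> x = 0"
proof -
  define S where "S = closure {x. \<phi> x \<noteq> 0}"
  have S: "S \<subseteq> {a<..<b}" "closed S"
    using assms by (auto simp: test_functions_def S_def)
  then have "compact S"
    using bounded_subset[OF bounded_box[of a b]] by (simp add: compact_eq_bounded_closed)
  have out: "\<phi> x = 0" if "x \<notin> S" for x
    using that closure_subset[of "{x. \<phi> x \<noteq> 0}"] by (auto simp: S_def)
  show ?thesis
  proof (cases "S = {}")
    case True
    \<comment> \<open>Here the function vanishes identically, so any endpoints with a < c and d < b
      serve; the interval may even be empty.\<close>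
    then show ?thesis using out that[of "a + 1" "b - 1"] by auto
  next
    case False
    obtain c where "c \<in> S" "\<forall>x\<in>S. c \<le> x"
      using compact_attains_inf[OF \<open>compact S\<close> False] by blast
    moreover obtain d where "d \<in> S" "\<forall>x\<in>S. x \<le> d"
      using compact_attains_sup[OF \<open>compact S\<close> False] by blast
    ultimately show ?thesis
      using S out by (intro that[of c d]) auto
  qed
qed

text \<open>Local integrability only controls compact subintervals of (a,b), whereas the weak
  derivative is stated with integrals over [a,b]. Since products with test functions vanish off such
  a subinterval, extension by zero bridges the two.\<close>

lemma
  fixes f :: "real \<Rightarrow> real"
  assumes f: "f absolutely_integrable_on S" and "S \<subseteq> T"
    and T: "T \<in> sets lebesgue" and 0: "\<And>x. x \<in> T - S \<Longrightarrow> f x = 0"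
  shows integrable_lebesgue_on_superset: "integrable (lebesgue_on T) f"
    and lebesgue_integral_superset: "(LINT x|lebesgue_on T. f x) = integral S f"
proof -
  let ?f = "\<lambda>x. if x \<in> S then f x else 0"
  have "?f absolutely_integrable_on UNIV"
    using f by (simp only: absolutely_integrable_restrict_UNIV)
  moreover have "?f = (\<lambda>x. if x \<in> T then f x else 0)"
    using \<open>S \<subseteq> T\<close> 0 by (intro ext) auto
  ultimately have "f absolutely_integrable_on T"
    by (simp only: absolutely_integrable_restrict_UNIV)
  then show int: "integrable (lebesgue_on T) f"
    using absolutely_integrable_imp_integrable T by blast
  have "integral T f = integral T ?f"
    using 0 by (intro Henstock_Kurzweil_Integration.integral_cong) auto
  also have "\<dots> = integral S f"
    using \<open>S \<subseteq> T\<close> by (simp add: Henstock_Kurzweil_Integration.integral_restrict_Int Int_absorb2)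
  finally show "(LINT x|lebesgue_on T. f x) = integral S f"
    using lebesgue_integral_eq_integral[OF int T] by simp
qed

lemma absolutely_integrable_mult_continuous:
  fixes f g :: "real \<Rightarrow> real"
  assumes "f absolutely_integrable_on {c..d}" "continuous_on {c..d} g"
  shows "(\<lambda>x. f x * g x) absolutely_integrable_on {c..d}"
proof -
  have "(\<lambda>x. g x * f x) absolutely_integrable_on {c..d}"
    using assms compact_continuous_image[OF assms(2)]
    by (intro absolutely_integrable_bounded_measurable_product_real)
      (auto intro: continuous_imp_measurable_on_sets_lebesgue compact_imp_bounded)
  then show ?thesis by (simp add: mult.commute)
qed

lemma integrable_mult_test_function:
  assumes f: "locally_integrable a b f" and \<phi>: "\<phi> \<in> test_functions a b"
  shows "integrable (lebesgue_on {a..b}) (\<lambda>x. f x * \<phi> x)"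
proof -
  obtain c d where cd: "a < c" "d < b" "\<And>x. x \<notin> {c..d} \<Longrightarrow> \<phi> x = 0"
    using test_function_support[OF \<phi>] by blast
  then have "(\<lambda>x. f x * \<phi> x) absolutely_integrable_on {c..d}"
    using f smooth_continuous_on[OF test_function_smooth[OF \<phi>]]
    by (intro absolutely_integrable_mult_continuous) (auto simp: locally_integrable_def)
  then show ?thesis
    by (rule integrable_lebesgue_on_superset) (use cd in auto)
qed

lemma locally_integrable_diff:
  "locally_integrable a b f \<Longrightarrow> locally_integrable a b g \<Longrightarrow> locally_integrable a b (\<lambda>x. f x - g x)"
  by (auto simp: locally_integrable_def intro: set_integral_diff(1))

section \<open>The fundamental lemma of the calculus of variations\<close>

lemma integral_eq_0_imp_AE_eq_0:
  fixes f :: "real \<Rightarrow> real"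
  assumes "\<And>x y. x \<le> y \<Longrightarrow> (f has_integral 0) {x..y}"
  shows "negligible {x. f x \<noteq> 0}"
proof -
  have 0: "(f has_integral 0) (cbox x y)" for x y
    by (cases "x \<le> y") (use assms in auto)
  then obtain N where N: "negligible N"
    "\<And>x e. x \<notin> N \<Longrightarrow> 0 < e \<Longrightarrow> \<exists>d>0. \<forall>h. 0 < h \<and> h < d \<longrightarrow>
       norm (integral (cbox x (x + h *\<^sub>R One)) f /\<^sub>R h ^ DIM(real) - f x) < e"
    using integrable_ccontinuous_explicit[OF has_integral_integrable[OF 0]] by metis
  have "f x = 0" if x: "x \<notin> N" for x
  proof (rule ccontr)
    assume "f x \<noteq> 0"
    then have "\<bar>f x\<bar> > 0" by simp
    from N(2)[OF x this] obtain d where d: "d > 0" "\<And>h. 0 < h \<and> h < d \<Longrightarrow>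
       norm (integral (cbox x (x + h *\<^sub>R One)) f /\<^sub>R h ^ DIM(real) - f x) < \<bar>f x\<bar>"
      by blast
    \<comment> \<open>The average of f over [x, x + d/2] is 0, so the Lebesgue differentiation
      estimate reads |f x| < |f x|.\<close>
    show False
      using d(2)[of "d / 2"] d(1) integral_unique[OF 0] by simp
  qed
  then have "{x. f x \<noteq> 0} \<subseteq> N" by blast
  with N(1) show ?thesis by (rule negligible_subset)
qed

text \<open>Dominated convergence with majorant |h|: each integral of h against a bump is 0 by
  assumption, and the bumps converge to the indicator of (p,q).\<close>

lemma integral_eq_0_of_test_functions:
  assumes h: "locally_integrable a b h"
    and test: "\<And>\<phi>. \<phi> \<in> test_functions a b \<Longrightarrow> (LINT x|lebesgue_on {a..b}. h x * \<phi> x) = 0"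
    and pq: "a < p" "q < b"
  shows "(h has_integral 0) {p..q}"
proof -
  have hpq: "h absolutely_integrable_on {p..q}"
    using h pq by (simp add: locally_integrable_def)
  have prod: "(\<lambda>x. h x * bump p q n x) absolutely_integrable_on {p..q}" for n
    by (intro absolutely_integrable_mult_continuous hpq smooth_continuous_on smooth_bump)
  have zero: "integral {p..q} (\<lambda>x. h x * bump p q n x) = 0" for n
  proof -
    have "(LINT x|lebesgue_on {a..b}. h x * bump p q n x) = integral {p..q} (\<lambda>x. h x * bump p q n x)"
      by (rule lebesgue_integral_superset[OF prod]) (use pq in \<open>auto simp: bump_eq_0\<close>)
    then show ?thesis
      using test[OF bump_test_function[OF pq]] by simp
  qed
  have le: "norm (h x * bump p q n x) \<le> norm (h x)" for n x
    using mult_left_le[OF bump_bounds(2)[of p q n x], of "\<bar>h x\<bar>"]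
    by (simp add: abs_mult bump_bounds(1))
  have lim: "(\<lambda>n. h x * bump p q n x) \<longlonglongrightarrow> h x * indicator {p<..<q} x" for x
    by (intro tendsto_intros bump_tendsto_indicator)
  have int: "(\<lambda>x. h x * bump p q n x) integrable_on {p..q}" "(\<lambda>x. norm (h x)) integrable_on {p..q}" for n
    using prod hpq by (simp_all add: absolutely_integrable_on_def)
  have "((\<lambda>x. h x * indicator {p<..<q} x) has_integral 0) {p..q}"
    using dominated_convergence[where f="\<lambda>n x. h x * bump p q n x" and S="{p..q}", OF int le lim]
    by (simp add: has_integral_iff zero LIMSEQ_const_iff)
  then show ?thesis
    \<comment> \<open>The indicator of the open interval misses only the two endpoints.\<close>
    by (rule has_integral_spike_finite[of "{p, q}", rotated 2]) (auto simp: indicator_def)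
qed

text \<open>As h need not be integrable up to a and b, it is first shown to vanish almost everywhere
  on each [c,d] inside (a,b); countably many such intervals and the two endpoints cover
  [a,b].\<close>

lemma fundamental_lemma_variations:
  assumes h: "locally_integrable a b h"
    and test: "\<And>\<phi>. \<phi> \<in> test_functions a b \<Longrightarrow> (LINT x|lebesgue_on {a..b}. h x * \<phi> x) = 0"
  shows "negligible {x \<in> {a..b}. h x \<noteq> 0}"
proof -
  have cd: "negligible {x \<in> {c..d}. h x \<noteq> 0}" if "a < c" "d < b" for c d
  proof -
    \<comment> \<open>Cutting h off outside [c,d] gives a function on the whole line. Its integral
      over [x,y] is that of h over the intersection, an interval still inside (a,b).\<close>
    have "((\<lambda>x. if x \<in> {c..d} then h x else 0) has_integral 0) {x..y}" for x y
    proof -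
      have "(h has_integral 0) ({c..d} \<inter> {x..y})"
        unfolding Int_atLeastAtMost
        by (rule integral_eq_0_of_test_functions[OF h test]) (use that in auto)
      then show ?thesis
        by (simp only: has_integral_restrict_Int inf_commute)
    qed
    then have "negligible {x. (if x \<in> {c..d} then h x else 0) \<noteq> 0}"
      by (intro integral_eq_0_imp_AE_eq_0)
    then show ?thesis
      by (rule negligible_subset) auto
  qed
  have "negligible ({a, b} \<union> (\<Union>n. {x \<in> {a + inverse (Suc n)..b - inverse (Suc n)}. h x \<noteq> 0}))"
    by (intro negligible_Un negligible_Union_nat cd) auto
  moreover have "{x \<in> {a..b}. h x \<noteq> 0} \<subseteq>
    {a, b} \<union> (\<Union>n. {x \<in> {a + inverse (Suc n)..b - inverse (Suc n)}. h x \<noteq> 0})"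
  proof
    fix x assume x: "x \<in> {x \<in> {a..b}. h x \<noteq> 0}"
    show "x \<in> {a, b} \<union> (\<Union>n. {x \<in> {a + inverse (Suc n)..b - inverse (Suc n)}. h x \<noteq> 0})"
    proof (cases "x = a \<or> x = b")
      case False
      with x have "0 < min (x - a) (b - x)" by auto
      then obtain n where "inverse (real (Suc n)) < min (x - a) (b - x)"
        using reals_Archimedean by blast
      then have "x \<in> {a + inverse (Suc n)..b - inverse (Suc n)}" by auto
      with x show ?thesis by blast
    qed auto
  qed
  ultimately show ?thesis by (rule negligible_subset)
qed

section \<open>Weak derivatives: uniqueness, differences, classical derivatives\<close>

lemma has_weak_deriv_unique:
  assumes g: "has_weak_deriv k a b f g" and h: "has_weak_deriv k a b f h"
  shows "negligible {x \<in> {a..b}. g x \<noteq> h x}"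
proof -
  have loc: "locally_integrable a b g" "locally_integrable a b h"
    using g h by (auto simp: has_weak_deriv_def)
  \<comment> \<open>Both weak derivatives are tested against the same integral of f, so the sign
    cancels; integrability of the two products allows the integral of the difference to be
    split.\<close>
  have "(LINT x|lebesgue_on {a..b}. (g x - h x) * \<phi> x) = 0" if \<phi>: "\<phi> \<in> test_functions a b" for \<phi>
  proof -
    let ?I = "LINT x|lebesgue_on {a..b}. f x * (deriv ^^ k) \<phi> x"
    have "?I = (- 1) ^ k * (LINT x|lebesgue_on {a..b}. g x * \<phi> x)"
      "?I = (- 1) ^ k * (LINT x|lebesgue_on {a..b}. h x * \<phi> x)"
      using g h \<phi> unfolding has_weak_deriv_def by blast+
    then have "(LINT x|lebesgue_on {a..b}. g x * \<phi> x) = (LINT x|lebesgue_on {a..b}. h x * \<phi> x)"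
      by simp
    then show ?thesis
      by (simp add: left_diff_distrib integrable_mult_test_function loc \<phi>)
  qed
  then have "negligible {x \<in> {a..b}. g x - h x \<noteq> 0}"
    by (intro fundamental_lemma_variations locally_integrable_diff loc)
  then show ?thesis by simp
qed

lemma has_weak_deriv_weak_deriv:
  assumes "has_weak_deriv k a b f g" shows "has_weak_deriv k a b f (weak_deriv k a b f)"
  unfolding weak_deriv_def using assms by (metis someI)

text \<open>This makes the products with \<open>(deriv ^^ k) \<phi>\<close> integrable, as needed to
  split integrals for differences of weakly differentiable functions.\<close>

lemma funpow_deriv_test_function:
  "\<phi> \<in> test_functions a b \<Longrightarrow> (deriv ^^ k) \<phi> \<in> test_functions a b"
  by (induction k) (auto intro: test_function_deriv)

lemma has_weak_deriv_diff:
  assumes "has_weak_deriv k a b f f'" "has_weak_deriv k a b g g'"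
  shows "has_weak_deriv k a b (\<lambda>x. f x - g x) (\<lambda>x. f' x - g' x)"
  unfolding has_weak_deriv_def
proof (intro conjI ballI)
  show "locally_integrable a b (\<lambda>x. f x - g x)" "locally_integrable a b (\<lambda>x. f' x - g' x)"
    using assms by (auto simp: has_weak_deriv_def intro: locally_integrable_diff)
  fix \<phi> assume \<phi>: "\<phi> \<in> test_functions a b"
  show "(LINT x|lebesgue_on {a..b}. (f x - g x) * (deriv ^^ k) \<phi> x) =
      (- 1) ^ k * (LINT x|lebesgue_on {a..b}. (f' x - g' x) * \<phi> x)"
    using assms \<phi> funpow_deriv_test_function[OF \<phi>, of k]
    by (simp add: has_weak_deriv_def left_diff_distrib right_diff_distrib integrable_mult_test_function)
qed

text \<open>Integration by parts: the fundamental theorem of calculus applies to the product of u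
  and a test function, whose boundary values are 0. One-sided derivatives of u at a and b are
  enough.\<close>

lemma has_weak_deriv_1_classical:
  assumes "a < b"
    and u: "\<And>x. x \<in> {a..b} \<Longrightarrow> (u has_real_derivative u' x) (at x within {a..b})"
    and u': "continuous_on {a..b} u'"
  shows "has_weak_deriv 1 a b u u'"
  unfolding has_weak_deriv_def
proof (intro conjI ballI)
  have cont: "continuous_on {a..b} u"
    using u by (rule DERIV_continuous_on)
  have loc: "locally_integrable a b g" if "continuous_on {a..b} g" for g :: "real \<Rightarrow> real"
    unfolding locally_integrable_def
    by (intro allI impI absolutely_integrable_continuous_real continuous_on_subset[OF that]) auto
  show "locally_integrable a b u" "locally_integrable a b u'"
    using loc cont u' by auto
  fix \<phi> assume \<phi>: "\<phi> \<in> test_functions a b"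
  then have sm: "smooth \<phi>" by (rule test_function_smooth)
  have "\<phi> x = 0" if "x \<notin> {a<..<b}" for x
    using \<phi> closure_subset[of "{x. \<phi> x \<noteq> 0}"] that by (auto simp: test_functions_def)
  then have "((\<lambda>x. u x * deriv \<phi> x + u' x * \<phi> x) has_integral u b * \<phi> b - u a * \<phi> a) {a..b}"
    using \<open>a < b\<close>
    by (intro fundamental_theorem_of_calculus)
      (auto simp flip: has_real_derivative_iff_has_vector_derivative
        intro!: DERIV_mult' u has_field_derivative_at_within[OF smooth_has_real_derivative[OF sm]])
  moreover have "\<phi> a = 0" "\<phi> b = 0"
    using \<open>\<And>x. x \<notin> {a<..<b} \<Longrightarrow> \<phi> x = 0\<close> by auto
  moreover have int: "integrable (lebesgue_on {a..b}) (\<lambda>x. u x * deriv \<phi> x)"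
    "integrable (lebesgue_on {a..b}) (\<lambda>x. u' x * \<phi> x)"
    using \<phi> loc cont u' by (intro integrable_mult_test_function test_function_deriv; simp)+
  ultimately have "(LINT x|lebesgue_on {a..b}. u x * deriv \<phi> x + u' x * \<phi> x) = 0"
    by (subst lebesgue_integral_eq_integral) (auto intro: integral_unique)
  then show "(LINT x|lebesgue_on {a..b}. u x * (deriv ^^ 1) \<phi> x) =
      (- 1) ^ 1 * (LINT x|lebesgue_on {a..b}. u' x * \<phi> x)"
    using int by simp
qed

section \<open>The boundary value problem\<close>

lemma l2_space_imp_integrable:
  assumes "f \<in> l2_space a b" shows "integrable (lebesgue_on {a..b}) f"
proof (rule Bochner_Integration.integrable_bound)
  show "integrable (lebesgue_on {a..b}) (\<lambda>x. 1 + (f x)\<^sup>2)"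
    using assms by (auto simp: l2_space_def integrable_const_ivl)
  \<comment> \<open>From (|y| - 1)^2 >= 0; the constant 1 is integrable because the interval is
    bounded.\<close>
  have "\<bar>y\<bar> \<le> 1 + y\<^sup>2" for y :: real
    using zero_le_power2[of "\<bar>y\<bar> - 1"] by (simp add: power2_diff)
  then show "AE x in lebesgue_on {a..b}. norm (f x) \<le> norm (1 + (f x)\<^sup>2)"
    by (simp add: abs_of_nonneg add_nonneg_nonneg)
qed (use assms in \<open>auto simp: l2_space_def\<close>)

lemma continuous_on_T_D:
  assumes "\<psi> \<in> l2_space a b" shows "continuous_on {a..b} (T_D a \<psi>)"
proof -
  have int: "integrable (lebesgue_on {a..b}) \<psi>"
    using assms by (rule l2_space_imp_integrable)
  have "T_D a \<psi> x = integral {a..x} \<psi>" if "x \<in> {a..b}" for x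
    unfolding T_D_def
    by (rule lebesgue_integral_eq_integral)
      (use that integrable_subinterval[OF int, of a x] in auto)
  then have eq: "integral {a..x} \<psi> = T_D a \<psi> x" if "x \<in> {a..b}" for x
    using that by simp
  have "continuous_on {a..b} (\<lambda>x. integral {a..x} \<psi>)"
    by (intro indefinite_integral_continuous_1 integrable_on_lebesgue_on int) simp
  then show ?thesis
    by (rule continuous_on_eq) (rule eq)
qed

text \<open>The difference of two solutions has second derivative 0, hence is affine, c x + d. An
  affine function that vanishes at two distinct points is 0.\<close>

lemma solves_bvp_unique:
  assumes "a < b" and u: "solves_bvp a b \<psi> u" and v: "solves_bvp a b \<psi> v" and x: "x \<in> {a..b}"
  shows "u x = v x"
proof -
  obtain u' where u': "\<And>x. x \<in> {a..b} \<Longrightarrow> (u has_real_derivative u' x) (at x within {a..b})"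
    "\<And>x. x \<in> {a..b} \<Longrightarrow> (u' has_real_derivative - T_D a \<psi> x) (at x within {a..b})"
    using u unfolding solves_bvp_def by blast
  obtain v' where v': "\<And>x. x \<in> {a..b} \<Longrightarrow> (v has_real_derivative v' x) (at x within {a..b})"
    "\<And>x. x \<in> {a..b} \<Longrightarrow> (v' has_real_derivative - T_D a \<psi> x) (at x within {a..b})"
    using v unfolding solves_bvp_def by blast
  have "((\<lambda>x. u' x - v' x) has_real_derivative 0) (at x within {a..b})" if "x \<in> {a..b}" for x
    using DERIV_diff[OF u'(2)[OF that] v'(2)[OF that]] by simp
  from has_field_derivative_zero_constant[OF convex_real_interval(5) this]
  obtain c where c: "\<And>x. x \<in> {a..b} \<Longrightarrow> u' x - v' x = c" by blast
  have "((\<lambda>x. u x - v x - c * x) has_real_derivative 0) (at x within {a..b})" if "x \<in> {a..b}" for x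
    using u'(1)[OF that] v'(1)[OF that] c[OF that] by (auto intro!: derivative_eq_intros)
  from has_field_derivative_zero_constant[OF convex_real_interval(5) this]
  obtain d where d: "\<And>x. x \<in> {a..b} \<Longrightarrow> u x - v x - c * x = d" by blast
  have "u a = 0" "u b = 0" "v a = 0" "v b = 0"
    using u v by (auto simp: solves_bvp_def)
  then have "d = - (c * a)" "d = - (c * b)"
    using d[of a] d[of b] \<open>a < b\<close> by simp_all
  then have "c * a = c * b" by linarith
  then have "c = 0" using \<open>a < b\<close> by simp
  then show ?thesis
    using d[OF x] d[of a] u v \<open>a < b\<close> by (simp add: solves_bvp_def)
qed

text \<open>Integrating \<open>- T_D a \<psi>\<close> twice from a solves the equation with value 0
  at a; subtracting a linear term corrects the value at b.\<close>

lemma solves_bvp_exists: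
  assumes "a < b" and \<psi>: "\<psi> \<in> l2_space a b"
  obtains u where "solves_bvp a b \<psi> u" "\<And>x. x \<notin> {a..b} \<Longrightarrow> u x = 0"
proof -
  define U where "U x = integral {a..x} (\<lambda>t. - T_D a \<psi> t)" for x
  have U: "(U has_real_derivative - T_D a \<psi> x) (at x within {a..b})" if "x \<in> {a..b}" for x
    unfolding U_def[abs_def]
    by (rule integral_has_real_derivative) (intro continuous_intros continuous_on_T_D \<psi> that)+
  define V where "V x = integral {a..x} U" for x
  have V: "(V has_real_derivative U x) (at x within {a..b})" if "x \<in> {a..b}" for x
    unfolding V_def[abs_def]
    by (rule integral_has_real_derivative[OF DERIV_continuous_on that]) (rule U)
  \<comment> \<open>The slope for which \<open>s * (x - a)\<close> vanishes at a and equals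
    \<open>V b\<close> at b.\<close>
  define s where "s = V b / (b - a)"
  define u where "u x = (if x \<in> {a..b} then V x - s * (x - a) else 0)" for x
  have "(u has_real_derivative U x - s) (at x within {a..b})" if "x \<in> {a..b}" for x
  proof -
    have "((\<lambda>x. V x - s * (x - a)) has_real_derivative U x - s) (at x within {a..b})"
      by (rule derivative_eq_intros V that refl | simp)+
    then show ?thesis
      by (rule has_field_derivative_transform_within[OF _ zero_less_one that])
        (use that in \<open>auto simp: u_def\<close>)
  qed
  moreover have "((\<lambda>x. U x - s) has_real_derivative - T_D a \<psi> x) (at x within {a..b})"
    if "x \<in> {a..b}" for x
    using DERIV_diff[OF U[OF that] DERIV_const[of s]] by simp
  moreover have "u a = 0" "u b = 0"
    using \<open>a < b\<close> by (auto simp: u_def V_def s_def)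
  ultimately have "solves_bvp a b \<psi> u"
    unfolding solves_bvp_def by (intro conjI exI[of _ "\<lambda>x. U x - s"]) auto
  then show ?thesis
    by (rule that) (auto simp: u_def)
qed

text \<open>Uniqueness holds only on [a,b]; the extension by zero turns it into equality of
  functions, so the definite description denotes the constructed solution.\<close>

lemma solves_bvp_bvp_solution:
  assumes "a < b" "\<psi> \<in> l2_space a b"
  shows "solves_bvp a b \<psi> (bvp_solution a b \<psi>)"
proof -
  obtain u where u: "solves_bvp a b \<psi> u" "\<And>x. x \<notin> {a..b} \<Longrightarrow> u x = 0"
    using solves_bvp_exists[OF assms] by blast
  have "bvp_solution a b \<psi> = u"
    unfolding bvp_solution_def
  proof (rule the_equality)
    fix v assume v: "solves_bvp a b \<psi> v \<and> (\<forall>x. x \<notin> {a..b} \<longrightarrow> v x = 0)"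
    then show "v = u"
      using solves_bvp_unique[OF assms(1) _ u(1)] u(2) by (metis ext)
  qed (use u in auto)
  then show ?thesis using u(1) by simp
qed

section \<open>L2 estimates for chosen weak derivatives\<close>

lemma l2_space_spike:
  assumes f: "f \<in> l2_space a b" and neg: "negligible {x \<in> {a..b}. f x \<noteq> g x}"
  shows "g \<in> l2_space a b" "l2_norm a b g = l2_norm a b f"
proof -
  \<comment> \<open>Lebesgue measurability survives changes on a negligible set, so an arbitrary
    representative remains measurable.\<close>
  have spike: "h g \<in> borel_measurable (lebesgue_on {a..b})"
    if "h f \<in> borel_measurable (lebesgue_on {a..b})" "\<And>x. f x = g x \<Longrightarrow> h f x = h g x"
    for h :: "(real \<Rightarrow> real) \<Rightarrow> real \<Rightarrow> real"
  proof -
    have "h f measurable_on {a..b}"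
      using that(1) by (simp add: measurable_on_iff_borel_measurable)
    then have "h g measurable_on {a..b}"
      by (rule measurable_on_spike[OF _ neg]) (use that(2) in fastforce)
    then show ?thesis by (simp add: measurable_on_iff_borel_measurable)
  qed
  have gm: "g \<in> borel_measurable (lebesgue_on {a..b})"
    using spike[of "\<lambda>f. f"] f by (auto simp: l2_space_def)
  have ae: "AE x in lebesgue_on {a..b}. (f x)\<^sup>2 = (g x)\<^sup>2"
    by (rule AE_I'[of "{x \<in> {a..b}. f x \<noteq> g x}"])
      (use neg in \<open>auto simp: negligible_iff_null_sets null_sets_restrict_space\<close>)
  show "g \<in> l2_space a b"
    using f gm integrable_cong_AE_imp[of "lebesgue_on {a..b}" "\<lambda>x. (f x)\<^sup>2" "\<lambda>x. (g x)\<^sup>2"] ae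
    by (auto simp: l2_space_def)
  show "l2_norm a b g = l2_norm a b f"
    using f gm ae unfolding l2_norm_def
    by (intro arg_cong[where f=sqrt] integral_cong_AE) (auto simp: l2_space_def)
qed

lemma l2_space_continuous:
  assumes "continuous_on {a..b} f" shows "f \<in> l2_space a b"
proof -
  have "integrable (lebesgue_on {a..b}) (\<lambda>x. (f x)\<^sup>2)"
    by (intro continuous_imp_integrable_real continuous_on_power assms)
  then show ?thesis
    using continuous_imp_measurable_on_sets_lebesgue[OF assms] by (simp add: l2_space_def)
qed

lemma weak_deriv_in_l2_space:
  assumes "has_weak_deriv k a b f g" "g \<in> l2_space a b"
  shows "weak_deriv k a b f \<in> l2_space a b"
  using l2_space_spike(1)[OF assms(2) has_weak_deriv_unique[OF assms(1)]]
    has_weak_deriv_weak_deriv[OF assms(1)] by blast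

text \<open>The classical derivative of the solution is continuous, hence square integrable, and the
  chosen weak derivative agrees with it almost everywhere.\<close>

lemma weak_deriv_bvp_solution_in_l2_space:
  assumes "a < b" "\<psi> \<in> l2_space a b"
  shows "weak_deriv 1 a b (bvp_solution a b \<psi>) \<in> l2_space a b"
proof -
  obtain u' where u':
    "\<And>x. x \<in> {a..b} \<Longrightarrow> (bvp_solution a b \<psi> has_real_derivative u' x) (at x within {a..b})"
    "\<And>x. x \<in> {a..b} \<Longrightarrow> (u' has_real_derivative - T_D a \<psi> x) (at x within {a..b})"
    using solves_bvp_bvp_solution[OF assms] unfolding solves_bvp_def by blast
  have "continuous_on {a..b} u'"
    using u'(2) by (rule DERIV_continuous_on)
  then show ?thesis
    using has_weak_deriv_1_classical[OF assms(1) u'(1)]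
    by (intro weak_deriv_in_l2_space l2_space_continuous) auto
qed

lemma l2_norm_square: "(l2_norm a b f)\<^sup>2 = (LINT x|lebesgue_on {a..b}. (f x)\<^sup>2)"
  by (simp add: l2_norm_def)

lemma integrable_square_diff:
  assumes "f \<in> l2_space a b" "g \<in> l2_space a b"
  shows "integrable (lebesgue_on {a..b}) (\<lambda>x. (f x - g x)\<^sup>2)"
proof (rule Bochner_Integration.integrable_bound)
  show "integrable (lebesgue_on {a..b}) (\<lambda>x. 2 * (f x)\<^sup>2 + 2 * (g x)\<^sup>2)"
    using assms by (auto simp: l2_space_def)
  have "(y - z)\<^sup>2 \<le> 2 * y\<^sup>2 + 2 * z\<^sup>2" for y z :: real
    using zero_le_power2[of "y + z"] by (simp add: power2_eq_square algebra_simps)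
  then show "AE x in lebesgue_on {a..b}. norm ((f x - g x)\<^sup>2) \<le> norm (2 * (f x)\<^sup>2 + 2 * (g x)\<^sup>2)"
    by simp
qed (use assms in \<open>auto simp: l2_space_def\<close>)

lemma l2_norm_square_triangle:
  assumes "f \<in> l2_space a b" "g \<in> l2_space a b" "h \<in> l2_space a b"
  shows "(l2_norm a b (\<lambda>x. f x - h x))\<^sup>2 \<le>
    2 * (l2_norm a b (\<lambda>x. f x - g x))\<^sup>2 + 2 * (l2_norm a b (\<lambda>x. g x - h x))\<^sup>2"
proof -
  have "(x - z)\<^sup>2 \<le> 2 * (x - y)\<^sup>2 + 2 * (y - z)\<^sup>2" for x y z :: real
    \<comment> \<open>The right side minus the left side is exactly this square.\<close>
    using zero_le_power2[of "(x - y) - (y - z)"] by (simp add: power2_eq_square algebra_simps)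
  then have "(LINT x|lebesgue_on {a..b}. (f x - h x)\<^sup>2) \<le>
      (LINT x|lebesgue_on {a..b}. 2 * (f x - g x)\<^sup>2 + 2 * (g x - h x)\<^sup>2)"
    using assms
    by (intro integral_mono Bochner_Integration.integrable_add integrable_mult_right
        integrable_square_diff) auto
  also have "\<dots> = 2 * (LINT x|lebesgue_on {a..b}. (f x - g x)\<^sup>2) +
      2 * (LINT x|lebesgue_on {a..b}. (g x - h x)\<^sup>2)"
    using assms by (simp add: integrable_square_diff)
  finally show ?thesis by (simp add: l2_norm_square)
qed

lemma sobolev0_weak_deriv:
  assumes "u \<in> sobolev0 q a b" "1 \<le> q"
  shows "has_weak_deriv 1 a b u (weak_deriv 1 a b u)" "weak_deriv 1 a b u \<in> l2_space a b"
proof -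
  obtain g where "g \<in> l2_space a b" "has_weak_deriv 1 a b u g"
    using assms by (auto simp: sobolev0_def sobolev_def)
  then show "has_weak_deriv 1 a b u (weak_deriv 1 a b u)" "weak_deriv 1 a b u \<in> l2_space a b"
    using has_weak_deriv_weak_deriv weak_deriv_in_l2_space by blast+
qed

text \<open>\<open>h1_norm\<close> uses the representative chosen for u - v, while the functionals
  use those chosen for u and v separately. Uniqueness almost everywhere identifies the norms of the
  two.\<close>

lemma l2_norm_weak_deriv_diff_le_h1_norm:
  assumes "u \<in> sobolev0 q a b" "v \<in> sobolev0 q a b" "1 \<le> q"
  shows "l2_norm a b (\<lambda>x. weak_deriv 1 a b u x - weak_deriv 1 a b v x) \<le> h1_norm a b (\<lambda>x. u x - v x)"
proof -
  have wd: "has_weak_deriv 1 a b (\<lambda>x. u x - v x) (\<lambda>x. weak_deriv 1 a b u x - weak_deriv 1 a b v x)"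
    using assms by (intro has_weak_deriv_diff sobolev0_weak_deriv)
  have "(\<lambda>x. weak_deriv 1 a b u x - weak_deriv 1 a b v x) \<in> l2_space a b"
    using sobolev0_weak_deriv(2)[OF assms(1,3)] sobolev0_weak_deriv(2)[OF assms(2,3)]
      integrable_square_diff by (auto simp: l2_space_def)
  then have "l2_norm a b (\<lambda>x. weak_deriv 1 a b u x - weak_deriv 1 a b v x) =
      l2_norm a b (weak_deriv 1 a b (\<lambda>x. u x - v x))"
    using l2_space_spike(2) has_weak_deriv_unique[OF wd has_weak_deriv_weak_deriv[OF wd]] by metis
  then show ?thesis
    unfolding h1_norm_def by (simp add: real_le_rsqrt)
qed

theorem theorem5p4:
  fixes a b :: real
  assumes "a < b"
  shows "\<exists>c>0. \<exists>\<delta>\<^sub>0>0.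
    \<forall>u\<^sub>t \<in> sobolev0 3 a b. \<forall>\<psi> :: nat \<Rightarrow> real \<Rightarrow> real.
      (\<forall>m. \<psi> m \<in> l2_space a b) \<and> (\<lambda>m. G_functional a b u\<^sub>t (\<psi> m)) \<longlonglongrightarrow> 0 \<longrightarrow>
      (\<forall>\<delta>. 0 < \<delta> \<and> \<delta> \<le> \<delta>\<^sub>0 \<longrightarrow>
        (\<exists>M. \<forall>u \<in> sobolev0 3 a b. h1_norm a b (\<lambda>x. u x - u\<^sub>t x) \<le> \<delta> \<longrightarrow>
          (\<forall>m\<ge>M. G_functional a b u (\<psi> m) \<le> c * \<delta>\<^sup>2)))"
proof (rule exI[of _ 4], rule conjI, simp, rule exI[of _ 1], intro conjI ballI allI impI)
  fix u\<^sub>t \<psi> and \<delta> :: real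
  assume ut: "u\<^sub>t \<in> sobolev0 3 a b"
    and \<psi>_lim: "(\<forall>m. \<psi> m \<in> l2_space a b) \<and> (\<lambda>m. G_functional a b u\<^sub>t (\<psi> m)) \<longlonglongrightarrow> 0"
    and "0 < \<delta> \<and> \<delta> \<le> 1"
  then have "\<forall>\<^sub>F m in sequentially. G_functional a b u\<^sub>t (\<psi> m) < \<delta>\<^sup>2"
    by (intro order_tendstoD(2)) auto
  then obtain M where M: "\<And>m. m \<ge> M \<Longrightarrow> G_functional a b u\<^sub>t (\<psi> m) < \<delta>\<^sup>2"
    by (auto simp: eventually_sequentially)
  show "\<exists>M. \<forall>u \<in> sobolev0 3 a b. h1_norm a b (\<lambda>x. u x - u\<^sub>t x) \<le> \<delta> \<longrightarrow>
          (\<forall>m\<ge>M. G_functional a b u (\<psi> m) \<le> 4 * \<delta>\<^sup>2)"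
  proof (intro exI[of _ M] ballI allI impI)
    fix u m assume u: "u \<in> sobolev0 3 a b" and near: "h1_norm a b (\<lambda>x. u x - u\<^sub>t x) \<le> \<delta>" and m: "m \<ge> M"
    let ?d = "l2_norm a b (\<lambda>x. weak_deriv 1 a b u x - weak_deriv 1 a b u\<^sub>t x)"
    have "?d \<le> \<delta>"
      using l2_norm_weak_deriv_diff_le_h1_norm[OF u ut] near by simp
    then have "?d\<^sup>2 \<le> \<delta>\<^sup>2"
      by (rule power_mono) (simp add: l2_norm_def)
    \<comment> \<open>The triangle inequality passes through the weak derivative of
      \<open>u\<^sub>t\<close>, whose squared distance from that of the solution for
      \<open>\<psi> m\<close> is \<open>G_functional a b u\<^sub>t (\<psi> m)\<close>.\<close>
    moreover have "G_functional a b u (\<psi> m) \<le> 2 * ?d\<^sup>2 + 2 * G_functional a b u\<^sub>t (\<psi> m)"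
      unfolding G_functional_def using u ut \<psi>_lim assms
      by (intro l2_norm_square_triangle sobolev0_weak_deriv(2)[where q=3]
          weak_deriv_bvp_solution_in_l2_space) auto
    ultimately show "G_functional a b u (\<psi> m) \<le> 4 * \<delta>\<^sup>2"
      using M[OF m] by linarith
  qed
qed auto

end
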